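(* Let $n,k,d\in\mathbb{N}$ with $n=kd$ and $k\geq 2$. Then the code $C_1$ produced by the recursive construction described in the context is a $G_{\uparrow}\left(n,\tilde{M}_{k+1}^{\,d-1}\cdot k!,d\right)$; that is, $C_1$ is a cyclic Gray code in $S_n$ using only transitions $t_{\uparrow j}$ ($1<j\leq n$), it has exactly $\tilde{M}_{k+1}^{\,d-1}\cdot k!$ codewords, and any two distinct codewords $\sigma,\tau$ satisfy $d_\infty(\sigma,\tau)\geq d$.
   Context: $S_n$ is the group of permutations of $[n]=\{1,\dots,n\}$, $\sigma\tau=\sigma\circ\tau$; vector notation $\sigma=[\sigma(1),\dots,\sigma(n)]$. For $1\leq i<j\leq n$, $t_{i\uparrow j}:S_n\to S_n$ moves the entry in position $j$ to position $i$: $t_{i\uparrow j}([a_1,\dots,a_n])=[a_1,\dots,a_{i-1},a_j,a_i,a_{i+1},\dots,a_{j-1},a_{j+1},\dots,a_n]$. Put $t_{\uparrow j}=t_{1\uparrow j}$. A $G_{i\uparrow}(n,M)$ is a sequence $(c_1,\dots,c_M)$ of pairwise distinct elements of $S_n$ such that for every $r\in[M]$, $c_{(r\bmod M)+1}=t_{i\uparrow j_r}(c_r)$ for some $i<j_r\leq n$; $t_{i\uparrow j_1},\dots,t_{i\uparrow j_M}$ is its transition sequence. $G_\uparrow(n,M)$ means $G_{1\uparrow}(n,M)$. With $d_\infty(\sigma,\tau)=\max_{j\in[n]}|\sigma(j)-\tau(j)|$, a $G_{i\uparrow}(n,M,d)$ is a $G_{i\uparrow}(n,M)$ in which any two distinct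 codewords have $d_\infty$-distance at least $d$; $G_\uparrow(n,M,d)$ means $G_{1\uparrow}(n,M,d)$. A $\mathrm{G}^{\mathrm{aux}}_{\uparrow}(k,M)$ is a $G_\uparrow(k,M)$ code $C$ such that for all $q\in[k-1]$ and $\sigma\in C$, $(q,k)\circ\sigma\notin C$. For every $k\geq 3$ there is a $\mathrm{G}^{\mathrm{aux}}_{\uparrow}(k,\tilde{M}_k)$ code starting with the identity and whose first transition is $t_{\uparrow k}$, where $\tilde M_4=8$, $\tilde M_5=57$, $\tilde M_6=178$, $\tilde M_k=\frac{k!}{2}$ for odd $k\neq 5$, and $\tilde M_k=(k-3)\left(\frac{(k-1)!}{2}+2\right)+1$ for even $k>6$; fix such codes. Also for every $k$ there is a complete cyclic code $G_\uparrow(k,k!)$ (known); fix one. Construction ($n=kd$, $k\ge2$). Codes $C_d,C_{d-1},\dots,C_1$ are built recursively. Base: $C_d$ starts at $\sigma_0\in S_n$, $\sigma_0(j)=d\,(j\bmod k)+\lceil j/k\rceil$. If $t_{\uparrow r_1},\dots,t_{\uparrow r_{k!}}$ is the transition sequence of the complete $G_\uparrow(k,k!)$, then $C_d$ has transition sequence $t_{k(d-1)+1\uparrow k(d-1)+r_1},\dots,t_{k(d-1)+1\uparrow k(d-1)+r_{k!}}$. Step: let $t_{\uparrow k+1},t_{\uparrow i_2},\dots,t_{\uparrow i_{\tilde M_{k+1}}}$ be the transition sequence of the fixed $\mathrm{G}^{\mathrm{aux}}_{\uparrow}(k+1,\tilde M_{k+1})$. $C_m$ also starts at $\sigma_0$,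 and its transition sequence is obtained from that of $C_{m+1}$ by replacing each transition $t_{km+1\uparrow j}$ with $t_{k(m-1)+1\uparrow j}$ followed by $t_{k(m-1)+1\uparrow k(m-1)+i_2},t_{k(m-1)+1\uparrow k(m-1)+i_3},\dots,t_{k(m-1)+1\uparrow k(m-1)+i_{\tilde M_{k+1}}}$ (applied in this order). *)

theory Defs
  imports Complex_Main "HOL-Combinatorics.Permutations"
begin

(* An element of S_n is a function that permutes {1..n} (hence is the identity outside {1..n});
   its vector notation lists the values at 1, ..., n. *)

definition push_to :: "nat \<Rightarrow> nat \<Rightarrow> (nat \<Rightarrow> nat) \<Rightarrow> (nat \<Rightarrow> nat)" where
  "push_to i j \<sigma> =
     (\<lambda>p. if p = i then \<sigma> j else if i < p \<and> p \<le> j then \<sigma> (p - 1) else \<sigma> p)"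

(* Transition sequences t_{i,j_1}, ..., t_{i,j_M} with a common target position i are represented
   by the list [j_1, ..., j_M].  Lists are indexed from 0, so the successor of the last
   codeword is the first one. *)
definition transition_seq :: "nat \<Rightarrow> nat \<Rightarrow> (nat \<Rightarrow> nat) list \<Rightarrow> nat list \<Rightarrow> bool" where
  "transition_seq i n c js \<longleftrightarrow>
     length js = length c \<and>
     (\<forall>r < length c. i < js ! r \<and> js ! r \<le> n \<and>
        c ! (Suc r mod length c) = push_to i (js ! r) (c ! r))"

definition gray_code :: "nat \<Rightarrow> nat \<Rightarrow> nat \<Rightarrow> (nat \<Rightarrow> nat) list \<Rightarrow> bool" where
  "gray_code i n M c \<longleftrightarrow>
     length c = M \<and> distinct c \<and> (\<forall>\<sigma> \<in> set c. \<sigma> permutes {1..n}) \<and>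
     (\<exists>js. transition_seq i n c js)"

definition dist_inf :: "nat \<Rightarrow> (nat \<Rightarrow> nat) \<Rightarrow> (nat \<Rightarrow> nat) \<Rightarrow> int" where
  "dist_inf n \<sigma> \<tau> = Max ((\<lambda>j. \<bar>int (\<sigma> j) - int (\<tau> j)\<bar>) ` {1..n})"

definition gray_code_dist :: "nat \<Rightarrow> nat \<Rightarrow> nat \<Rightarrow> nat \<Rightarrow> (nat \<Rightarrow> nat) list \<Rightarrow> bool" where
  "gray_code_dist i n M d c \<longleftrightarrow>
     gray_code i n M c \<and>
     (\<forall>\<sigma> \<in> set c. \<forall>\<tau> \<in> set c. \<sigma> \<noteq> \<tau> \<longrightarrow> int d \<le> dist_inf n \<sigma> \<tau>)"

definition gray_aux :: "nat \<Rightarrow> nat \<Rightarrow> (nat \<Rightarrow> nat) list \<Rightarrow> bool" where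
  "gray_aux k M c \<longleftrightarrow>
     gray_code 1 k M c \<and>
     (\<forall>q \<in> {1..k - 1}. \<forall>\<sigma> \<in> set c. transpose q k \<circ> \<sigma> \<notin> set c)"

(* Only meant for k >= 3, where both divisions by 2 are exact. *)
definition aux_size :: "nat \<Rightarrow> nat" where
  "aux_size k =
     (if k = 4 then 8
      else if k = 5 then 57
      else if k = 6 then 178
      else if odd k then fact k div 2
      else (k - 3) * (fact (k - 1) div 2 + 2) + 1)"

definition start_perm :: "nat \<Rightarrow> nat \<Rightarrow> (nat \<Rightarrow> nat)" where
  "start_perm k d =
     (\<lambda>j. if j \<in> {1..k * d} then d * (j mod k) + nat \<lceil>real j / real k\<rceil> else j)"

(* The transitions of the code C_m, for 1 <= m <= d, all with target position k(m-1)+1.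
   Here rs is the transition sequence of the complete code on S_k, and us = [k+1, i_2, ...] that
   of the auxiliary code on S_{k+1}.  The replaced transition has target position km+1 and the
   one replacing it k(m-1)+1, so its list entry j does not change. *)
function constr_trans :: "nat \<Rightarrow> nat \<Rightarrow> nat list \<Rightarrow> nat list \<Rightarrow> nat \<Rightarrow> nat list" where
  "constr_trans k d rs us m =
     (if d \<le> m then map (\<lambda>r. k * (d - 1) + r) rs
      else concat (map (\<lambda>j. j # map (\<lambda>i. k * (m - 1) + i) (tl us))
                       (constr_trans k d rs us (m + 1))))"
  by pat_completeness auto
termination
  by (relation "measure (\<lambda>(k, d, rs, us, m). d - m)") auto

declare constr_trans.simps [simp del]

(* The codewords visited from a start word; the word reached after the last transition is
   not listed, since in a cyclic code it is the start word again. *)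
primrec codewords :: "nat \<Rightarrow> (nat \<Rightarrow> nat) \<Rightarrow> nat list \<Rightarrow> (nat \<Rightarrow> nat) list" where
  "codewords i \<sigma> [] = []"
| "codewords i \<sigma> (j # js) = \<sigma> # codewords i (push_to i j \<sigma>) js"

definition constr_code :: "nat \<Rightarrow> nat \<Rightarrow> nat list \<Rightarrow> nat list \<Rightarrow> nat \<Rightarrow> (nat \<Rightarrow> nat) list" where
  "constr_code k d rs us m =
     codewords (k * (m - 1) + 1) (start_perm k d) (constr_trans k d rs us m)"

end

theory Submission
  imports Defs
begin

text \<open>
  A transition multiplies a codeword on the right, and \<open>t\<^bsub>s+1,j\<^esub> = t\<^bsub>s+1,s+k+1\<^esub> \<circ> t\<^bsub>s+k+1,j\<^esub>\<close> for
  \<open>j > s + k + 1\<close>. With \<open>s = k (m - 1)\<close> it follows that each replacement in the passage from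
  \<open>C\<^bsub>m+1\<^esub>\<close> to \<open>C\<^sub>m\<close> performs the old transition and then runs once through the auxiliary code on
  the window of positions \<open>s + 1, \<dots>, s + k + 1\<close>. Hence the codewords of \<open>C\<^sub>m\<close> are the products
  of a codeword \<open>c\<close> of \<open>C\<^bsub>m+1\<^esub>\<close> and an auxiliary codeword \<open>a\<close> acting on that window.

  Inside the window, \<open>c\<close> takes its \<open>k\<close> initial values, which are congruent modulo \<open>d\<close>, and
  one further value, labelled \<open>k + 1\<close> by \<open>a\<close>. If the products of \<open>c, a\<close> and \<open>c', a'\<close> are at
  distance less than \<open>d\<close>, then \<open>a\<close> and \<open>a'\<close> agree at all positions where neither of them has the
  label \<open>k + 1\<close>. So either \<open>a = a'\<close>, and then \<open>c\<close> and \<open>c'\<close> are at distance less than \<open>d\<close>, or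
  \<open>a' = (q, k + 1) \<circ> a\<close> for some \<open>q\<close>, which the auxiliary code excludes.
\<close>

subsection \<open>Words visited by a sequence of transitions\<close>

text \<open>Companion of \<open>codewords\<close> that drops the start and keeps the final word. A
  replacement block leaves its start word at once for another turn of the auxiliary code, so the
  words it reaches are the ones that belong together.\<close>

primrec words_after :: "nat \<Rightarrow> (nat \<Rightarrow> nat) \<Rightarrow> nat list \<Rightarrow> (nat \<Rightarrow> nat) list" where
  "words_after i \<sigma> [] = []"
| "words_after i \<sigma> (j # js) = push_to i j \<sigma> # words_after i (push_to i j \<sigma>) js"

lemma length_codewords [simp]: "length (codewords i \<sigma> js) = length js"
  by (induction js arbitrary: \<sigma>) auto

lemma codewords_append_fold:
  "codewords i \<sigma> js @ [fold (push_to i) js \<sigma>] = \<sigma> # words_after i \<sigma> js"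
  by (induction js arbitrary: \<sigma>) auto

lemma words_after_append:
  "words_after i \<sigma> (xs @ ys) = words_after i \<sigma> xs @ words_after i (fold (push_to i) xs \<sigma>) ys"
  by (induction xs arbitrary: \<sigma>) auto

lemma rotate1_codewords:
  assumes "fold (push_to i) js \<sigma> = \<sigma>"
  shows "rotate1 (codewords i \<sigma> js) = words_after i \<sigma> js"
  using codewords_append_fold[of i \<sigma> js] assms by (cases js) auto

lemma set_words_after:
  assumes "fold (push_to i) js \<sigma> = \<sigma>"
  shows "set (words_after i \<sigma> js) = set (codewords i \<sigma> js)"
  using rotate1_codewords[OF assms] by (metis set_rotate1)

lemma nth_codewords:
  "r < length js \<Longrightarrow> codewords i \<sigma> js ! r = fold (push_to i) (take r js) \<sigma>"
  by (induction js arbitrary: \<sigma> r) (auto simp: nth_Cons split: nat.split)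

lemma transition_seq_codewords:
  assumes "fold (push_to i) js \<sigma> = \<sigma>" and "\<forall>j \<in> set js. i < j \<and> j \<le> n"
  shows "transition_seq i n (codewords i \<sigma> js) js"
  unfolding transition_seq_def
proof (intro conjI allI impI)
  fix r assume "r < length (codewords i \<sigma> js)"
  then have r: "r < length js" by simp
  then show "i < js ! r" "js ! r \<le> n" using assms(2) by auto
  have step: "fold (push_to i) (take (Suc r) js) \<sigma> = push_to i (js ! r) (codewords i \<sigma> js ! r)"
    using r by (simp add: nth_codewords take_Suc_conv_app_nth)
  show "codewords i \<sigma> js ! (Suc r mod length (codewords i \<sigma> js))
      = push_to i (js ! r) (codewords i \<sigma> js ! r)"
  proof (cases "Suc r = length js")
    case True
    moreover have "js \<noteq> []" using r by auto
    ultimately show ?thesis using step assms(1) by (simp add: nth_codewords)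
  next
    case False
    then show ?thesis using step r by (simp add: nth_codewords)
  qed
qed simp

lemma transition_seqD:
  assumes "transition_seq i n c js" and "c \<noteq> []"
  shows "c = codewords i (hd c) js" and "fold (push_to i) js (hd c) = hd c"
    and "\<forall>j \<in> set js. i < j \<and> j \<le> n"
proof -
  have step: "c ! (Suc r mod length c) = push_to i (js ! r) (c ! r)" if "r < length c" for r
    using assms(1) that by (simp add: transition_seq_def)
  have len: "length js = length c" using assms(1) by (simp add: transition_seq_def)
  \<comment> \<open>Reducing the index modulo the length admits \<open>r = length c\<close>: smaller
    \<open>r\<close> give the codewords, and this last case gives the closing condition.\<close>
  have nth: "c ! (r mod length c) = fold (push_to i) (take r js) (hd c)" if "r \<le> length c" for r
    using that
  proof (induction r)
    case 0
    then show ?case using assms(2) by (simp add: hd_conv_nth)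
  next
    case (Suc r)
    then show ?case using step[of r] len by (simp add: take_Suc_conv_app_nth)
  qed
  show "c = codewords i (hd c) js"
  proof (rule nth_equalityI)
    fix r assume "r < length c"
    then show "c ! r = codewords i (hd c) js ! r" using nth[of r] len by (simp add: nth_codewords)
  qed (simp add: len)
  show "fold (push_to i) js (hd c) = hd c"
    using nth[of "length c"] len assms(2) by (simp add: hd_conv_nth)
  show "\<forall>j \<in> set js. i < j \<and> j \<le> n"
    using assms(1) len by (auto simp: transition_seq_def in_set_conv_nth)
qed

text \<open>A transition rearranges positions, so it multiplies on the right and commutes with
  relabelling of values on the left. Hence one transition sequence can be transferred between start
  words.\<close>

lemma push_to_comp: "push_to i j (\<sigma> \<circ> \<tau>) = \<sigma> \<circ> push_to i j \<tau>"
  by (auto simp: push_to_def)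

lemma fold_push_to_comp: "fold (push_to i) js (\<sigma> \<circ> \<tau>) = \<sigma> \<circ> fold (push_to i) js \<tau>"
  by (induction js arbitrary: \<tau>) (auto simp: push_to_comp)

lemma codewords_comp: "codewords i (\<sigma> \<circ> \<tau>) js = map ((\<circ>) \<sigma>) (codewords i \<tau> js)"
  by (induction js arbitrary: \<tau>) (auto simp: push_to_comp)

lemma bij_fix_permutes:
  assumes "\<And>x. x \<notin> S \<Longrightarrow> p x = x" "bij p"
  shows "p permutes S"
  using assms by (simp add: permutes_def bij_iff)

lemma push_to_id_permutes:
  assumes "1 \<le> i" "i < j" "j \<le> n"
  shows "push_to i j id permutes {1..n}"
proof (rule bij_fix_permutes)
  show "push_to i j id x = x" if "x \<notin> {1..n}" for x
    using that assms by (auto simp: push_to_def)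
  \<comment> \<open>\<open>push_to i j id\<close> is a cycle on the positions
    \<open>i, ..., j\<close>; \<open>g\<close> is the reverse cycle.\<close>
  define g where "g = (\<lambda>p. if p = j then i else if i \<le> p \<and> p < j then p + 1 else p)"
  show "bij (push_to i j id)"
    by (rule o_bij[of g]) (use assms in \<open>auto simp: fun_eq_iff push_to_def g_def\<close>)
qed

lemma push_to_permutes:
  assumes "\<sigma> permutes {1..n}" "1 \<le> i" "i < j" "j \<le> n"
  shows "push_to i j \<sigma> permutes {1..n}"
  using permutes_compose[OF push_to_id_permutes[OF assms(2-4)] assms(1)] push_to_comp[of i j \<sigma> id]
  by simp

lemma codewords_permutes:
  assumes "\<sigma> permutes {1..n}" "1 \<le> i" "\<forall>j \<in> set js. i < j \<and> j \<le> n" "c \<in> set (codewords i \<sigma> js)"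
  shows "c permutes {1..n}"
  using assms
proof (induction js arbitrary: \<sigma>)
  case (Cons j js)
  then show ?case using push_to_permutes[of \<sigma> n i j] by auto
qed simp

text \<open>Moving an entry up to position \<open>i\<close> disturbs no position before
  \<open>i\<close>. With \<open>i = s + k + 1\<close>, all codewords carry the initial values on the
  first \<open>k\<close> positions of the window.\<close>

lemma codewords_below:
  assumes "c \<in> set (codewords i \<sigma> js)" "p < i"
  shows "c p = \<sigma> p"
  using assms by (induction js arbitrary: \<sigma>) (auto simp: push_to_def)

subsection \<open>Permutations acting on a window\<close>

text \<open>The window has no explicit upper end: a permutation of \<open>{1..l}\<close> fixes
  larger arguments, so its shift fixes the positions above \<open>s + l\<close>.\<close>

definition shift :: "nat \<Rightarrow> (nat \<Rightarrow> nat) \<Rightarrow> nat \<Rightarrow> nat" where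
  "shift s \<tau> p = (if p \<le> s then p else s + \<tau> (p - s))"

lemma shift_id [simp]: "shift s id = id"
  by (auto simp: shift_def fun_eq_iff)

lemma shift_add [simp]: "0 < x \<Longrightarrow> shift s \<tau> (s + x) = s + \<tau> x"
  by (simp add: shift_def)

lemma push_to_shift:
  assumes "1 < j"
  shows "push_to (Suc s) (s + j) (shift s \<tau>) = shift s (push_to 1 j \<tau>)"
proof
  fix p
  show "push_to (Suc s) (s + j) (shift s \<tau>) p = shift s (push_to 1 j \<tau>) p"
    using assms by (cases "p \<le> s"; cases "p = Suc s") (auto simp: push_to_def shift_def)
qed

lemma fold_push_to_shift:
  assumes "\<forall>j \<in> set js. 1 < j"
  shows "fold (push_to (Suc s)) (map ((+) s) js) (shift s \<tau>) = shift s (fold (push_to 1) js \<tau>)"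
  using assms by (induction js arbitrary: \<tau>) (auto simp: push_to_shift)

lemma codewords_shift:
  assumes "\<forall>j \<in> set js. 1 < j"
  shows "codewords (Suc s) (shift s \<tau>) (map ((+) s) js) = map (shift s) (codewords 1 \<tau> js)"
  using assms by (induction js arbitrary: \<tau>) (auto simp: push_to_shift)

lemma shift_permutes:
  assumes "a permutes {1..l}" "s + l \<le> n"
  shows "shift s a permutes {1..n}"
proof (rule bij_fix_permutes)
  \<comment> \<open>For the two shifts below to cancel, positions above \<open>s\<close> must stay
    above \<open>s\<close>, so \<open>a\<close> and \<open>inv a\<close> must preserve
    positivity.\<close>
  have range: "0 < a x \<longleftrightarrow> 0 < x" "0 < inv a x \<longleftrightarrow> 0 < x" for x
    using permutes_in_image[OF assms(1), of x] permutes_not_in[OF assms(1), of x]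
      permutes_in_image[OF permutes_inv[OF assms(1)], of x]
      permutes_not_in[OF permutes_inv[OF assms(1)], of x]
    by (cases "x \<in> {1..l}"; auto)+
  show "shift s a x = x" if "x \<notin> {1..n}" for x
  proof -
    have "x - s \<notin> {1..l}" using that assms(2) by (cases "x = 0") auto
    then show ?thesis using permutes_not_in[OF assms(1)] by (simp add: shift_def)
  qed
  show "bij (shift s a)"
  proof (rule o_bij[of "shift s (inv a)"])
    show "shift s (inv a) \<circ> shift s a = id" "shift s a \<circ> shift s (inv a) = id"
      by (auto simp: fun_eq_iff shift_def range permutes_inverses[OF assms(1)])
  qed
qed

subsection \<open>The initial word\<close>

text \<open>The ceiling is \<open>Suc b\<close> throughout block \<open>b\<close>, counted from 0.
  So the values on a block are congruent modulo \<open>d\<close>.\<close>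

lemma start_perm_block:
  assumes "j \<in> {k * b + 1..k * b + k}" "b < d"
  shows "start_perm k d j = d * (j mod k) + Suc b" and "j \<in> {1..k * d}"
proof -
  have k: "k > 0" using assms by auto
  have "k * Suc b \<le> k * d" using assms(2) by (intro mult_left_mono) auto
  then show *: "j \<in> {1..k * d}" using assms(1) by auto
  have "real k * real b < real j" "real j \<le> real k * (real b + 1)"
    using assms(1) by (auto simp: algebra_simps simp flip: of_nat_mult of_nat_add)
  then have "\<lceil>real j / real k\<rceil> = int b + 1"
    using k by (intro ceiling_unique) (auto simp: field_simps)
  then show "start_perm k d j = d * (j mod k) + Suc b"
    using * by (simp add: start_perm_def nat_add_distrib)
qed

lemma block_exists:
  fixes j k d :: nat
  assumes "j \<in> {1..k * d}"
  obtains b where "b < d" "j \<in> {k * b + 1..k * b + k}"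
proof -
  have k: "k > 0" using assms by (cases k) auto
  define b where "b = (j - 1) div k"
  have "b < d" unfolding b_def
    using assms by (intro less_mult_imp_div_less) (auto simp: mult.commute)
  moreover have "k * b \<le> j - 1" "j - 1 < k * b + k"
    unfolding b_def using dividend_less_times_div[OF k, of "j - 1"]
    by (simp_all only: times_div_less_eq_dividend add.commute)
  then have "j \<in> {k * b + 1..k * b + k}" using assms by (simp, linarith)
  ultimately show thesis using that by blast
qed

lemma mod_eq_in_block:
  fixes p q s k :: nat
  assumes "p \<in> {s + 1..s + k}" "q \<in> {s + 1..s + k}" "p mod k = q mod k"
  shows "p = q"
proof (rule ccontr)
  assume "p \<noteq> q"
  moreover have "k dvd q - p" "k dvd p - q" using assms(3)
    by (metis mod_eq_dvd_iff_nat nat_le_linear diff_is_0_eq dvd_0_right)+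
  moreover have "q - p < k" "p - q < k" using assms(1,2) by auto
  ultimately show False by (metis nat_dvd_not_less diff_is_0_eq le_antisym not_gr_zero)
qed

text \<open>A value minus 1 is \<open>d * (j mod k) + b\<close> with \<open>b < d\<close>. Division
  by \<open>d\<close> recovers the block and the residue of \<open>j\<close>, and these determine
  \<open>j\<close>.\<close>

lemma start_perm_permutes: "start_perm k d permutes {1..k * d}"
proof (rule bij_imp_permutes)
  show "start_perm k d x = x" if "x \<notin> {1..k * d}" for x
    using that by (auto simp: start_perm_def)
  have inj: "inj_on (start_perm k d) {1..k * d}"
  proof (rule inj_onI)
    fix p q assume pq: "p \<in> {1..k * d}" "q \<in> {1..k * d}" and eq: "start_perm k d p = start_perm k d q"
    obtain b where b: "b < d" "p \<in> {k * b + 1..k * b + k}" using block_exists[OF pq(1)] .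
    obtain b' where b': "b' < d" "q \<in> {k * b' + 1..k * b' + k}" using block_exists[OF pq(2)] .
    have e: "d * (p mod k) + b = d * (q mod k) + b'"
      using eq start_perm_block(1)[OF b(2,1)] start_perm_block(1)[OF b'(2,1)] by simp
    have "b = b'" using arg_cong[OF e, of "\<lambda>x. x mod d"] b b' by simp
    moreover have "p mod k = q mod k" using arg_cong[OF e, of "\<lambda>x. x div d"] b b' by simp
    ultimately show "p = q" using mod_eq_in_block b b' by blast
  qed
  have "start_perm k d ` {1..k * d} \<subseteq> {1..k * d}"
  proof clarify
    fix p assume p: "p \<in> {1..k * d}"
    obtain b where b: "b < d" "p \<in> {k * b + 1..k * b + k}" using block_exists[OF p] .
    have "k > 0" using b by auto
    then have "d * Suc (p mod k) \<le> d * k" by (intro mult_left_mono) (simp_all add: Suc_leI)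
    then show "start_perm k d p \<in> {1..k * d}"
      using start_perm_block(1)[OF b(2,1)] b by (auto simp: algebra_simps)
  qed
  then show "bij_betw (start_perm k d) {1..k * d} {1..k * d}"
    using inj by (simp add: bij_betw_def endo_inj_surj)
qed

text \<open>Distance less than \<open>d\<close>, written pointwise to avoid the maximum. It is
  reflexive for \<open>d \<ge> 1\<close>, so separation statements also yield injectivity.\<close>

definition close :: "nat \<Rightarrow> nat \<Rightarrow> (nat \<Rightarrow> nat) \<Rightarrow> (nat \<Rightarrow> nat) \<Rightarrow> bool" where
  "close n d \<sigma> \<tau> \<longleftrightarrow> (\<forall>p \<in> {1..n}. \<bar>int (\<sigma> p) - int (\<tau> p)\<bar> < int d)"

lemma dist_inf_ge_iff:
  assumes "n \<ge> 1"
  shows "int d \<le> dist_inf n \<sigma> \<tau> \<longleftrightarrow> \<not> close n d \<sigma> \<tau>"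
  unfolding dist_inf_def close_def using assms by (subst Max_ge_iff) (auto simp: not_less)

text \<open>Values in one block differ by \<open>d\<close> times a difference of residues modulo
  \<open>k\<close>, which must vanish if the gap is below \<open>d\<close>.\<close>

lemma start_perm_gap:
  assumes "p \<in> {k * b + 1..k * b + k}" "q \<in> {k * b + 1..k * b + k}" "b < d"
    and "\<bar>int (start_perm k d p) - int (start_perm k d q)\<bar> < int d"
  shows "p = q"
proof -
  have "int (start_perm k d p) - int (start_perm k d q) = int d * (int (p mod k) - int (q mod k))"
    unfolding start_perm_block(1)[OF assms(1,3)] start_perm_block(1)[OF assms(2,3)]
    by (simp add: algebra_simps)
  then have "int d * \<bar>int (p mod k) - int (q mod k)\<bar> < int d * 1"
    using assms(4) by (simp add: abs_mult)
  then have "\<bar>int (p mod k) - int (q mod k)\<bar> < 1"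
    using assms(3) by (subst (asm) mult_less_cancel_left_pos) auto
  then have "p mod k = q mod k" by linarith
  then show ?thesis using mod_eq_in_block assms(1,2) by blast
qed

subsection \<open>Closeness of products\<close>

text \<open>If \<open>k + 1\<close> sits at \<open>i\<close> in \<open>a\<close> and at
  \<open>i'\<close> in \<open>a'\<close>, the two agree elsewhere. For \<open>i \<noteq> i'\<close>
  the only value left for \<open>a' i\<close> is \<open>a i'\<close>, so two labels are
  swapped.\<close>

lemma permutes_eq_or_transpose:
  fixes k :: nat
  assumes "a permutes {1..k + 1}" "a' permutes {1..k + 1}"
    and agree: "\<And>x. x \<in> {1..k + 1} \<Longrightarrow> a x \<noteq> k + 1 \<Longrightarrow> a' x \<noteq> k + 1 \<Longrightarrow> a x = a' x"
  shows "a' = a \<or> (\<exists>q \<in> {1..k}. a' = transpose q (k + 1) \<circ> a)"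
proof -
  note inj = permutes_inj[OF assms(1), THEN inj_eq] permutes_inj[OF assms(2), THEN inj_eq]
  have out: "a x = x" "a' x = x" if "x \<notin> {1..k + 1}" for x
    using that assms(1,2) permutes_not_in by metis+
  obtain i i' where i: "a i = k + 1" "a' i' = k + 1"
    using permutes_surj[OF assms(1)] permutes_surj[OF assms(2)] by (metis surjD)
  have agree': "a x = a' x" if "x \<noteq> i" "x \<noteq> i'" for x
    using that agree[of x] out[of x] i inj by (cases "x \<in> {1..k + 1}") metis+
  show ?thesis
  proof (cases "i = i'")
    case True
    then show ?thesis using agree' i by (metis ext)
  next
    case False
    have i'_in: "i' \<in> {1..k + 1}" using out(2)[of i'] i(2) by (cases "i' \<in> {1..k + 1}") auto
    then have "a i' \<in> {1..k + 1}" using permutes_in_image[OF assms(1)] by blast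
    moreover have "a i' \<noteq> k + 1" using False i inj by metis
    ultimately have q: "a i' \<in> {1..k}" by auto
    \<comment> \<open>\<open>z\<close> is where \<open>a\<close> takes the value
      \<open>a' i\<close>; at any \<open>z\<close> other than \<open>i\<close> and
      \<open>i'\<close>, \<open>a'\<close> would repeat that value.\<close>
    obtain z where z: "a z = a' i" using permutes_surj[OF assms(1)] by (metis surjD)
    have "z = i'"
    proof (rule ccontr)
      assume "z \<noteq> i'"
      moreover have "z \<noteq> i" using z i False inj by metis
      ultimately show False using agree' z inj by metis
    qed
    then have "a' i = a i'" using z by simp
    have "a' x = (transpose (a i') (k + 1) \<circ> a) x" for x
    proof -
      consider "x = i" | "x = i'" | "x \<noteq> i" "x \<noteq> i'" by blast
      then show ?thesis
      proof cases
        case 3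
        then have "a x \<noteq> a i'" "a x \<noteq> k + 1" using i inj by metis+
        then show ?thesis using agree'[OF 3] by (simp add: transpose_def)
      qed (use i \<open>a' i = a i'\<close> in simp_all)
    qed
    then show ?thesis using q by blast
  qed
qed

text \<open>Labels up to \<open>k\<close> address window positions where \<open>c\<close> and
  \<open>c'\<close> both coincide with \<open>\<sigma>\<close>, whose values there are at least
  \<open>d\<close> apart; so closeness forces equal labels. Label \<open>k + 1\<close> addresses a
  position where \<open>c\<close> and \<open>c'\<close> may differ, hence the condition
  \<open>aux\<close>.\<close>

lemma close_product:
  assumes cl: "close n d (c \<circ> shift s a) (c' \<circ> shift s a')"
    and a: "a permutes {1..k + 1}" "a' permutes {1..k + 1}" and "s + (k + 1) \<le> n"
    and c: "\<And>p. p \<le> s + k \<Longrightarrow> c p = \<sigma> p" "\<And>p. p \<le> s + k \<Longrightarrow> c' p = \<sigma> p"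
    and gap: "\<And>p q. p \<in> {s + 1..s + k} \<Longrightarrow> q \<in> {s + 1..s + k} \<Longrightarrow>
                \<bar>int (\<sigma> p) - int (\<sigma> q)\<bar> < int d \<Longrightarrow> p = q"
    and aux: "\<And>q. q \<in> {1..k} \<Longrightarrow> a' \<noteq> transpose q (k + 1) \<circ> a"
  shows "a' = a \<and> close n d c c'"
proof
  show *: "a' = a"
  proof -
    have "a x = a' x" if x: "x \<in> {1..k + 1}" and "a x \<noteq> k + 1" "a' x \<noteq> k + 1" for x
    proof -
      have "a x \<in> {1..k + 1}" "a' x \<in> {1..k + 1}"
        using x permutes_in_image[OF a(1)] permutes_in_image[OF a(2)] by blast+
      then have in_k: "a x \<in> {1..k}" "a' x \<in> {1..k}" using that by auto
      have "s + x \<in> {1..n}" using x assms(4) by auto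
      then have "\<bar>int (c (shift s a (s + x))) - int (c' (shift s a' (s + x)))\<bar> < int d"
        using cl unfolding close_def by fastforce
      then have "\<bar>int (\<sigma> (s + a x)) - int (\<sigma> (s + a' x))\<bar> < int d"
        using x in_k c by simp
      then have "s + a x = s + a' x" using in_k by (intro gap) auto
      then show ?thesis by simp
    qed
    then show ?thesis using permutes_eq_or_transpose[OF a] aux by blast
  qed
  show "close n d c c'" unfolding close_def
  proof
    fix p assume p: "p \<in> {1..n}"
    have sh: "shift s a permutes {1..n}" using shift_permutes[OF a(1) assms(4)] .
    \<comment> \<open>Once \<open>a' = a\<close>, the common shift merely reorders positions and can
      be undone.\<close>
    obtain p' where "p' \<in> {1..n}" "shift s a p' = p"
      using p permutes_image[OF sh] by (metis imageE)
    then show "\<bar>int (c p) - int (c' p)\<bar> < int d" using cl * unfolding close_def by fastforce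
  qed
qed

subsection \<open>One step of the construction\<close>

text \<open>Lifting an entry in two stages moves each entry it passes exactly once.\<close>

lemma push_to_push_to:
  assumes "i < l" "l < j"
  shows "push_to i l (push_to l j \<sigma>) = push_to i j \<sigma>"
  using assms by (auto simp: push_to_def fun_eq_iff)

text \<open>The auxiliary cycle is entered at its second word and left at its first, the identity;
  this causes the rotation and makes the block end where the old transition ended.\<close>

lemma macro_transition:
  assumes us: "us = (k + 1) # us'" "\<forall>j \<in> set us. 1 < j" "fold (push_to 1) us id = id"
    and j: "s + k + 1 < j" and k: "k > 0"
  shows "fold (push_to (Suc s)) (j # map ((+) s) us') \<sigma> = push_to (s + k + 1) j \<sigma>"
    and "words_after (Suc s) \<sigma> (j # map ((+) s) us')
      = map (\<lambda>a. push_to (s + k + 1) j \<sigma> \<circ> shift s a) (rotate1 (codewords 1 id us))"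
proof -
  define \<sigma>' where "\<sigma>' = push_to (s + k + 1) j \<sigma>"
  \<comment> \<open>The new first transition is the old one followed by the first transition of the
    auxiliary code, which is why that code has to begin with \<open>k + 1\<close>.\<close>
  have first: "push_to (Suc s) j \<sigma> = push_to (Suc s) (s + (k + 1)) \<sigma>'"
    using push_to_push_to[of "Suc s" "s + k + 1" j \<sigma>] j k by (simp add: \<sigma>'_def)
  have closed: "fold (push_to (Suc s)) (map ((+) s) us) \<sigma>' = \<sigma>'"
    using fold_push_to_comp[of "Suc s" "map ((+) s) us" \<sigma>' "shift s id"]
      fold_push_to_shift[OF us(2), of s id] us(3) by simp
  show "fold (push_to (Suc s)) (j # map ((+) s) us') \<sigma> = push_to (s + k + 1) j \<sigma>"
    using closed first by (simp add: us(1) \<sigma>'_def)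
  have "words_after (Suc s) \<sigma> (j # map ((+) s) us') = words_after (Suc s) \<sigma>' (map ((+) s) us)"
    using first by (simp add: us(1))
  also have "\<dots> = rotate1 (codewords (Suc s) \<sigma>' (map ((+) s) us))"
    using rotate1_codewords[OF closed] by simp
  also have "codewords (Suc s) \<sigma>' (map ((+) s) us) = map (\<lambda>a. \<sigma>' \<circ> shift s a) (codewords 1 id us)"
    using codewords_comp[of "Suc s" \<sigma>' "shift s id" "map ((+) s) us"]
      codewords_shift[OF us(2), of s id] by simp
  finally show "words_after (Suc s) \<sigma> (j # map ((+) s) us')
      = map (\<lambda>a. push_to (s + k + 1) j \<sigma> \<circ> shift s a) (rotate1 (codewords 1 id us))"
    by (simp add: rotate1_map \<sigma>'_def)
qed

lemma macro_transitions:
  assumes us: "us = (k + 1) # us'" "\<forall>j \<in> set us. 1 < j" "fold (push_to 1) us id = id"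
    and "\<forall>j \<in> set js. s + k + 1 < j" and k: "k > 0"
  defines "ts \<equiv> concat (map (\<lambda>j. j # map ((+) s) us') js)"
  shows "fold (push_to (Suc s)) ts \<sigma> = fold (push_to (s + k + 1)) js \<sigma>"
    and "words_after (Suc s) \<sigma> ts
      = concat (map (\<lambda>c. map (\<lambda>a. c \<circ> shift s a) (rotate1 (codewords 1 id us)))
          (words_after (s + k + 1) \<sigma> js))"
  using assms(4) unfolding ts_def
proof (induction js arbitrary: \<sigma>)
  case (Cons j js)
  {
    case 1
    then show ?case using Cons macro_transition(1)[OF us _ k, of s j \<sigma>] by simp
  next
    case 2
    then have j: "s + k + 1 < j" and js: "\<forall>j \<in> set js. s + k + 1 < j" by simp_all
    show ?case
      by (simp only: list.map concat.simps words_after_append macro_transition[OF us j k]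
          Cons.IH(2)[OF js] words_after.simps(2)[of "s + k + 1"])
  }
qed simp_all

subsection \<open>The recursion\<close>

text \<open>Invariant for the transitions of a code \<open>C_m\<close>, with
  \<open>s = k * (m - 1)\<close>, so that the target position is \<open>Suc s\<close>. The second
  conjunct makes the code cyclic.\<close>

definition good_transitions :: "nat \<Rightarrow> nat \<Rightarrow> nat \<Rightarrow> nat \<Rightarrow> nat list \<Rightarrow> bool" where
  "good_transitions k d M s js \<longleftrightarrow>
     (\<forall>j \<in> set js. Suc s < j \<and> j \<le> k * d) \<and>
     fold (push_to (Suc s)) js (start_perm k d) = start_perm k d \<and>
     length js = M \<and>
     distinct (codewords (Suc s) (start_perm k d) js) \<and>
     (\<forall>\<sigma> \<in> set (codewords (Suc s) (start_perm k d) js).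
        \<forall>\<tau> \<in> set (codewords (Suc s) (start_perm k d) js). close (k * d) d \<sigma> \<tau> \<longrightarrow> \<sigma> = \<tau>)"

text \<open>\<open>B\<close> may start at any word; multiplying it on the left by
  \<open>inv (hd B)\<close> makes its transitions run from the identity. They act on the last block,
  whose values are mutually at least \<open>d\<close> apart.\<close>

lemma good_transitions_base:
  assumes B: "gray_code 1 k M B" "transition_seq 1 k B rs" "M > 0" and "d \<ge> 1"
  shows "good_transitions k d M (k * (d - 1)) (map ((+) (k * (d - 1))) rs)"
proof -
  define s where "s = k * (d - 1)"
  define \<sigma> where "\<sigma> = start_perm k d"
  have n: "k * d = s + k" using \<open>d \<ge> 1\<close> by (cases d) (auto simp: s_def)
  have Bne: "B \<noteq> []" and Bp: "\<And>b. b \<in> set B \<Longrightarrow> b permutes {1..k}" and Bd: "distinct B"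
    and BM: "length B = M"
    using B by (auto simp: gray_code_def)
  note r = transition_seqD[OF B(2) Bne]
  have r1: "\<forall>j \<in> set rs. 1 < j" using r(3) by blast
  have h: "hd B permutes {1..k}" using Bp Bne by simp
  have inv: "inv (hd B) \<circ> hd B = id" using permutes_inv_o(2)[OF h] .
  have closed: "fold (push_to 1) rs id = id"
    using fold_push_to_comp[of 1 rs "inv (hd B)" "hd B"] r(2) inv by simp
  have words: "codewords 1 id rs = map ((\<circ>) (inv (hd B))) B"
    using codewords_comp[of 1 "inv (hd B)" "hd B" rs] r(1) inv by simp
  have D: "distinct (codewords 1 id rs)"
    unfolding words distinct_map
  proof (intro conjI Bd inj_onI)
    fix x y :: "nat \<Rightarrow> nat" assume "inv (hd B) \<circ> x = inv (hd B) \<circ> y"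
    then have "hd B \<circ> inv (hd B) \<circ> x = hd B \<circ> inv (hd B) \<circ> y" by (simp add: o_assoc[symmetric])
    then show "x = y" using permutes_inv_o(1)[OF h] by simp
  qed
  have P: "b permutes {1..k}" if "b \<in> set (codewords 1 id rs)" for b
    using codewords_permutes[OF permutes_id _ r(3) that] by simp
  have cw: "codewords (Suc s) \<sigma> (map ((+) s) rs) = map (\<lambda>b. \<sigma> \<circ> shift s b) (codewords 1 id rs)"
    using codewords_comp[of "Suc s" \<sigma> "shift s id" "map ((+) s) rs"]
      codewords_shift[OF r1, of s id] by simp
  have sep: "b = b'" if b: "b permutes {1..k}" "b' permutes {1..k}"
    and cl: "close (k * d) d (\<sigma> \<circ> shift s b) (\<sigma> \<circ> shift s b')" for b b'
  proof
    fix x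
    show "b x = b' x"
    proof (cases "x \<in> {1..k}")
      case False
      then show ?thesis using b permutes_not_in by metis
    next
      case True
      have mem: "b x \<in> {1..k}" "b' x \<in> {1..k}"
        using True permutes_in_image[OF b(1)] permutes_in_image[OF b(2)] by blast+
      have "s + x \<in> {1..k * d}" using True n by auto
      then have "\<bar>int (\<sigma> (shift s b (s + x))) - int (\<sigma> (shift s b' (s + x)))\<bar> < int d"
        using cl unfolding close_def by fastforce
      then have "\<bar>int (\<sigma> (s + b x)) - int (\<sigma> (s + b' x))\<bar> < int d" using True by simp
      \<comment> \<open>The positions \<open>s + 1, ..., s + k\<close> form block
        \<open>d - 1\<close>.\<close>
      then have "s + b x = s + b' x"
        using mem \<open>d \<ge> 1\<close> unfolding \<sigma>_def s_def by (intro start_perm_gap[of _ k "d - 1" _ d]) auto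
      then show ?thesis by simp
    qed
  qed
  have refl: "close (k * d) d \<tau> \<tau>" for \<tau> using \<open>d \<ge> 1\<close> by (simp add: close_def)
  show ?thesis
    unfolding good_transitions_def s_def[symmetric] \<sigma>_def[symmetric]
  proof (intro conjI)
    show "\<forall>j \<in> set (map ((+) s) rs). Suc s < j \<and> j \<le> k * d" using r(3) n by auto
    show "fold (push_to (Suc s)) (map ((+) s) rs) \<sigma> = \<sigma>"
      using fold_push_to_comp[of "Suc s" "map ((+) s) rs" \<sigma> "shift s id"]
        fold_push_to_shift[OF r1, of s id] closed by simp
    show "length (map ((+) s) rs) = M" using arg_cong[OF words, of length] BM by simp
    show "distinct (codewords (Suc s) \<sigma> (map ((+) s) rs))"
      unfolding cw distinct_map
    proof (intro conjI D inj_onI)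
      fix x y assume "x \<in> set (codewords 1 id rs)" "y \<in> set (codewords 1 id rs)"
        "\<sigma> \<circ> shift s x = \<sigma> \<circ> shift s y"
      then show "x = y" using sep P refl by metis
    qed
    show "\<forall>\<tau> \<in> set (codewords (Suc s) \<sigma> (map ((+) s) rs)).
        \<forall>\<tau>' \<in> set (codewords (Suc s) \<sigma> (map ((+) s) rs)). close (k * d) d \<tau> \<tau>' \<longrightarrow> \<tau> = \<tau>'"
      unfolding cw set_map using P sep by blast
  qed
qed

text \<open>The new codewords are the products of an old codeword and a shifted auxiliary one, and
  \<open>close_product\<close> recovers both factors from a product up to closeness.\<close>

lemma good_transitions_step:
  assumes A: "gray_aux (k + 1) N A" "transition_seq 1 (k + 1) A us" "N > 0" "hd A = id"
    "hd us = k + 1"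
    and k: "k > 0" and b: "Suc b < d" and js: "good_transitions k d M (k * Suc b) js"
  shows "good_transitions k d (N * M) (k * b) (concat (map (\<lambda>j. j # map ((+) (k * b)) (tl us)) js))"
proof -
  define s where "s = k * b"
  define \<sigma> where "\<sigma> = start_perm k d"
  define ts where "ts = concat (map (\<lambda>j. j # map ((+) s) (tl us)) js)"
  have s': "k * Suc b = s + k" by (simp add: s_def)
  \<comment> \<open>The window needs one position beyond block \<open>b\<close>, supplied by block
    \<open>b + 1\<close>.\<close>
  have "k * (b + 2) \<le> k * d" using b by (intro mult_left_mono) auto
  then have n: "s + (k + 1) \<le> k * d" using k by (simp add: s_def algebra_simps)
  have Ane: "A \<noteq> []" and Ap: "\<And>a. a \<in> set A \<Longrightarrow> a permutes {1..k + 1}" and Ad: "distinct A"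
    and AN: "length A = N"
    and aux: "\<And>q a. q \<in> {1..k} \<Longrightarrow> a \<in> set A \<Longrightarrow> transpose q (k + 1) \<circ> a \<notin> set A"
    using A by (auto simp: gray_code_def gray_aux_def)
  note r = transition_seqD[OF A(2) Ane, unfolded A(4)]
  have lus: "length us = N" using arg_cong[OF r(1), of length] AN by simp
  then have us: "us = (k + 1) # tl us" using A(3,5) by (cases us) auto
  have u1: "\<forall>j \<in> set us. 1 < j" using r(3) by blast
  define C where "C = set (codewords (s + k + 1) \<sigma> js)"
  have J: "\<forall>j \<in> set js. s + k + 1 < j \<and> j \<le> k * d"
    and Jc: "fold (push_to (s + k + 1)) js \<sigma> = \<sigma>" and Jl: "length js = M"
    and Jd: "distinct (codewords (s + k + 1) \<sigma> js)"
    and Js: "\<And>c c'. c \<in> C \<Longrightarrow> c' \<in> C \<Longrightarrow> close (k * d) d c c' \<Longrightarrow> c = c'"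
    using js unfolding good_transitions_def C_def s' \<sigma>_def by auto
  have J1: "\<forall>j \<in> set js. s + k + 1 < j" using J by blast
  note m = macro_transitions[OF us u1 r(2) J1 k, of \<sigma>, folded ts_def]
  have closed: "fold (push_to (Suc s)) ts \<sigma> = \<sigma>" using m(1) Jc by simp
  have len: "length ts = N * M"
  proof -
    have "length ts = (\<Sum>j\<leftarrow>js. Suc (length (tl us)))"
      unfolding ts_def by (simp add: length_concat comp_def)
    also have "\<dots> = N * M" using lus A(3) Jl by (simp add: sum_list_triv)
    finally show ?thesis .
  qed
  have img: "set (codewords (Suc s) \<sigma> ts) = (\<lambda>(c, a). c \<circ> shift s a) ` (C \<times> set A)"
    unfolding set_words_after[OF closed, symmetric] m(2)
    using set_words_after[OF Jc] r(1) by (auto simp: C_def)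
  have sep: "c = c' \<and> a = a'"
    if "c \<in> C" "c' \<in> C" "a \<in> set A" "a' \<in> set A"
      and cl: "close (k * d) d (c \<circ> shift s a) (c' \<circ> shift s a')" for c c' a a'
  proof -
    have "a' = a \<and> close (k * d) d c c'"
    proof (rule close_product[where \<sigma> = \<sigma>, OF cl Ap Ap n])
      show "c p = \<sigma> p" "c' p = \<sigma> p" if "p \<le> s + k" for p
        using codewords_below[of c _ _ _ p] codewords_below[of c' _ _ _ p] \<open>c \<in> C\<close> \<open>c' \<in> C\<close> that
        unfolding C_def by force+
      show "p = q" if "p \<in> {s + 1..s + k}" "q \<in> {s + 1..s + k}"
        "\<bar>int (\<sigma> p) - int (\<sigma> q)\<bar> < int d" for p q
        using start_perm_gap[of p k b q d] that b by (simp add: s_def \<sigma>_def)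
      show "a' \<noteq> transpose q (k + 1) \<circ> a" if "q \<in> {1..k}" for q
        using aux[OF that \<open>a \<in> set A\<close>] \<open>a' \<in> set A\<close> by metis
    qed fact+
    then show ?thesis using Js that by blast
  qed
  have refl: "close (k * d) d \<tau> \<tau>" for \<tau> using b by (simp add: close_def)
  \<comment> \<open>Distinctness follows by counting: injectivity gives \<open>N * M\<close>
    different words, as many as the list has entries.\<close>
  have "inj_on (\<lambda>(c, a). c \<circ> shift s a) (C \<times> set A)"
  proof (rule inj_onI, clarify)
    fix c a c' a'
    assume "c \<in> C" "a \<in> set A" "c' \<in> C" "a' \<in> set A" "c \<circ> shift s a = c' \<circ> shift s a'"
    then show "c = c' \<and> a = a'" using sep refl by metis
  qed
  then have "card (set (codewords (Suc s) \<sigma> ts)) = card C * card (set A)"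
    unfolding img by (simp add: card_image card_cartesian_product)
  also have "\<dots> = N * M"
    using distinct_card[OF Jd] distinct_card[OF Ad] Jl AN by (simp add: C_def)
  finally have D: "distinct (codewords (Suc s) \<sigma> ts)"
    using len by (intro card_distinct) simp
  have T: "Suc s < j \<and> j \<le> k * d" if j: "j \<in> set ts" for j
  proof -
    consider "j \<in> set js" | i where "i \<in> set (tl us)" "j = s + i" using j by (auto simp: ts_def)
    then show ?thesis
    proof cases
      case 1
      then show ?thesis using J k by auto
    next
      case 2
      then have "i \<in> set us" by (metis us list.set_intros(2))
      then have "1 < i" "i \<le> k + 1" using r(3) by auto
      then show ?thesis using 2 n by simp
    qed
  qed
  show ?thesis
    unfolding good_transitions_def s_def[symmetric] \<sigma>_def[symmetric] ts_def[symmetric]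
    using T closed len D
  proof (intro conjI)
    show "\<forall>\<tau> \<in> set (codewords (Suc s) \<sigma> ts). \<forall>\<tau>' \<in> set (codewords (Suc s) \<sigma> ts).
        close (k * d) d \<tau> \<tau>' \<longrightarrow> \<tau> = \<tau>'"
      unfolding img
    proof clarify
      fix c a c' a'
      assume "c \<in> C" "a \<in> set A" "c' \<in> C" "a' \<in> set A"
        "close (k * d) d (c \<circ> shift s a) (c' \<circ> shift s a')"
      then have "c = c' \<and> a = a'" by (intro sep)
      then show "c \<circ> shift s a = c' \<circ> shift s a'" by simp
    qed
  qed blast
qed

text \<open>Halving \<open>fact k\<close> leaves a positive number since
  \<open>fact k \<ge> 6\<close>. Positivity makes the auxiliary code nonempty, so that
  \<open>hd A\<close> is a codeword.\<close>

lemma aux_size_pos: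
  assumes "k \<ge> 3"
  shows "aux_size k > 0"
proof -
  have "fact 3 \<le> (fact k :: nat)" using assms by (intro fact_mono_nat)
  then show ?thesis by (auto simp: aux_size_def fact_numeral)
qed

text \<open>Since the recursion descends from \<open>C_d\<close>, the induction is on the number
  \<open>e\<close> of steps taken, with \<open>m = d - e\<close>; each step contributes one factor
  \<open>aux_size (k + 1)\<close>.\<close>

lemma good_transitions_constr:
  assumes "k \<ge> 2" "d \<ge> 1" "gray_code 1 k (fact k) B" "transition_seq 1 k B rs"
    and "gray_aux (k + 1) (aux_size (k + 1)) A" "transition_seq 1 (k + 1) A us"
    and "hd A = id" "hd us = k + 1" and "e < d"
  shows "good_transitions k d (aux_size (k + 1) ^ e * fact k) (k * (d - Suc e))
           (constr_trans k d rs us (d - e))"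
  using \<open>e < d\<close>
proof (induction e)
  case 0
  show ?case using good_transitions_base[OF assms(3,4) _ \<open>d \<ge> 1\<close>] by (simp add: constr_trans.simps)
next
  case (Suc e)
  \<comment> \<open>The new code has index \<open>Suc b\<close>, so its offset is
    \<open>k * b\<close>; the subtraction is exact because \<open>Suc e < d\<close>.\<close>
  define b where "b = d - Suc (Suc e)"
  have b: "d - Suc e = Suc b" "d - e = Suc (Suc b)" "Suc b < d" using Suc.prems by (auto simp: b_def)
  have "good_transitions k d (aux_size (k + 1) * (aux_size (k + 1) ^ e * fact k)) (k * b)
      (concat (map (\<lambda>j. j # map ((+) (k * b)) (tl us)) (constr_trans k d rs us (Suc (Suc b)))))"
    using Suc assms(1) b
    by (intro good_transitions_step[OF assms(5,6) aux_size_pos assms(7,8)]) auto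
  then show ?case
    using b by (simp add: constr_trans.simps[of k d rs us "Suc b"] b_def[symmetric] mult.assoc)
qed

theorem theorem17:
  fixes n k d :: nat
    and A B :: "(nat \<Rightarrow> nat) list"
    and rs us :: "nat list"
  assumes "n = k * d" and "k \<ge> 2" and "d \<ge> 1"
    and "gray_code 1 k (fact k) B" and "transition_seq 1 k B rs"
    and "gray_aux (k + 1) (aux_size (k + 1)) A" and "transition_seq 1 (k + 1) A us"
    and "hd A = id" and "hd us = k + 1"
  shows "gray_code_dist 1 n (aux_size (k + 1) ^ (d - 1) * fact k) d (constr_code k d rs us 1)
     \<and> transition_seq 1 n (constr_code k d rs us 1) (constr_trans k d rs us 1)"
proof -
  define ts where "ts = constr_trans k d rs us 1"
  have code: "constr_code k d rs us 1 = codewords 1 (start_perm k d) ts"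
    by (simp add: constr_code_def ts_def)
  \<comment> \<open>After \<open>d - 1\<close> steps \<open>m = 1\<close>, so the offset is 0 and
    the target position is 1.\<close>
  have good: "good_transitions k d (aux_size (k + 1) ^ (d - 1) * fact k) 0 ts"
    using good_transitions_constr[OF assms(2-9), of "d - 1"] \<open>d \<ge> 1\<close> by (simp add: ts_def)
  have range: "\<forall>j \<in> set ts. 1 < j \<and> j \<le> n"
    using good by (simp add: good_transitions_def assms(1))
  have seq: "transition_seq 1 n (codewords 1 (start_perm k d) ts) ts"
    using good range by (intro transition_seq_codewords) (simp_all add: good_transitions_def)
  have "n \<ge> 1" using assms(1-3) by simp
  then have "int d \<le> dist_inf n \<sigma> \<tau>"
    if "\<sigma> \<in> set (codewords 1 (start_perm k d) ts)" "\<tau> \<in> set (codewords 1 (start_perm k d) ts)"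
      "\<sigma> \<noteq> \<tau>" for \<sigma> \<tau>
    using good that by (auto simp: dist_inf_ge_iff good_transitions_def assms(1))
  moreover have "\<sigma> permutes {1..n}" if "\<sigma> \<in> set (codewords 1 (start_perm k d) ts)" for \<sigma>
    using codewords_permutes[OF _ _ range that] start_perm_permutes assms(1) by simp
  moreover have "distinct (codewords 1 (start_perm k d) ts)"
    and "length ts = aux_size (k + 1) ^ (d - 1) * fact k"
    using good by (simp_all add: good_transitions_def)
  ultimately show ?thesis
    using seq unfolding code ts_def[symmetric] gray_code_dist_def gray_code_def length_codewords
    by blast
qed

end
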